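(* Let $R>0$ and let $\mathcal{EH}_{[0,R]}^{<\omega}$ be the space of isometry classes of finite subsets of the interval $[0,R]$ (equivalently, of finite subsets of the real line of diameter at most $R$), endowed with the Euclidean-Hausdorff distance. Then $\mathcal{EH}_{[0,R]}^{<\omega}$ cannot be bi-Lipschitz embedded into a finite-dimensional Hilbert space.
   Context: Finite subsets of $\mathbb{R}$ are taken nonempty and regarded as metric spaces with the inherited metric. For $X,Y\subseteq\mathbb{R}$ the Hausdorff distance is $d_H(X,Y)=\inf_{\mathcal{R}}\sup_{(x,y)\in\mathcal{R}}|x-y|$, over correspondences $\mathcal{R}\subseteq X\times Y$ (relations in which every $x\in X$ is related to at least one $y\in Y$ and vice versa). The Euclidean-Hausdorff distance is $d_{EH}(X,Y)=\inf\{d_H(i_X(X),i_Y(Y))\mid i_X\colon X\to\mathbb{R},\ i_Y\colon Y\to\mathbb{R}\text{ isometric embeddings}\}$, equivalently $\inf_{f\in\operatorname{Isom}(\mathbb{R})}d_H(X,f(Y))$. It is a metric on isometry classes of finite subsets of $\mathbb{R}$. A map $\psi\colon(X,d_X)\to(Y,d_Y)$ between metric spaces is a bi-Lipschitz embedding if there are constants $a,b>0$ with $a\,d_X(x,y)\le d_Y(\psi(x),\psi(y))\le b\,d_X(x,y)$ for all $x,y\in X$. *)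

theory Defs
  imports "HOL-Analysis.Analysis"
begin

definition correspondence :: "'a set \<Rightarrow> 'b set \<Rightarrow> ('a \<times> 'b) set \<Rightarrow> bool" where
  "correspondence X Y C \<longleftrightarrow>
     C \<subseteq> X \<times> Y \<and> (\<forall>x\<in>X. \<exists>y\<in>Y. (x, y) \<in> C) \<and> (\<forall>y\<in>Y. \<exists>x\<in>X. (x, y) \<in> C)"

text \<open>Below, the real-valued \<open>INF\<close> and \<open>SUP\<close> are genuine for finite nonempty sets, which are the only
  ones considered: the suprema are taken over nonempty finite sets, and the infima over nonempty
  sets of nonnegative numbers.\<close>

definition hausdorff_dist :: "real set \<Rightarrow> real set \<Rightarrow> real" where
  "hausdorff_dist X Y = (INF C \<in> {C. correspondence X Y C}. SUP (x, y) \<in> C. \<bar>x - y\<bar>)"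

definition isometric_embedding_on :: "'a::metric_space set \<Rightarrow> ('a \<Rightarrow> 'b::metric_space) \<Rightarrow> bool" where
  "isometric_embedding_on X f \<longleftrightarrow> (\<forall>x\<in>X. \<forall>y\<in>X. dist (f x) (f y) = dist x y)"

definition eucl_hausdorff_dist :: "real set \<Rightarrow> real set \<Rightarrow> real" where
  "eucl_hausdorff_dist X Y =
     Inf {hausdorff_dist (i ` X) (j ` Y) | (i :: real \<Rightarrow> real) (j :: real \<Rightarrow> real).
            isometric_embedding_on X i \<and> isometric_embedding_on Y j}"

definition finite_subsets :: "real \<Rightarrow> real set set" where
  "finite_subsets R = {X. finite X \<and> X \<noteq> {} \<and> X \<subseteq> {0..R}}"

definition isometry_rel :: "real \<Rightarrow> (real set \<times> real set) set" where
  "isometry_rel R = {(X, Y). X \<in> finite_subsets R \<and> Y \<in> finite_subsets R \<and>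
     (\<exists>f. isometric_embedding_on X f \<and> f ` X = Y)}"

definition EH_space :: "real \<Rightarrow> real set set set" where
  "EH_space R = finite_subsets R // isometry_rel R"

text \<open>The distance descends to isometry classes; see \<open>EH_dist_class\<close> for independence of the
  representatives.\<close>

definition EH_dist :: "real set set \<Rightarrow> real set set \<Rightarrow> real" where
  "EH_dist P Q = the_elem (\<Union>X\<in>P. \<Union>Y\<in>Q. {eucl_hausdorff_dist X Y})"

definition bilipschitz_embedding ::
  "'a set \<Rightarrow> ('a \<Rightarrow> 'a \<Rightarrow> real) \<Rightarrow> 'b set \<Rightarrow> ('b \<Rightarrow> 'b \<Rightarrow> real) \<Rightarrow> ('a \<Rightarrow> 'b) \<Rightarrow> bool" where
  "bilipschitz_embedding X dX Y dY \<psi> \<longleftrightarrow> \<psi> \<in> X \<rightarrow> Y \<and>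
     (\<exists>a>0. \<exists>b>0. \<forall>x\<in>X. \<forall>y\<in>X.
        a * dX x y \<le> dY (\<psi> x) (\<psi> y) \<and> dY (\<psi> x) (\<psi> y) \<le> b * dX x y)"

lemma isometric_embedding_on_inv_into:
  assumes "isometric_embedding_on X f"
  shows "isometric_embedding_on (f ` X) (inv_into X f)" "inv_into X f ` f ` X = X"
proof -
  have inj: "inj_on f X"
    using assms unfolding isometric_embedding_on_def inj_on_def by (metis dist_eq_0_iff)
  then show "isometric_embedding_on (f ` X) (inv_into X f)"
    using assms unfolding isometric_embedding_on_def by auto
  show "inv_into X f ` f ` X = X"
    using inj by simp
qed

lemma isometric_embedding_on_comp:
  assumes "isometric_embedding_on X f" "isometric_embedding_on (f ` X) g"
  shows "isometric_embedding_on X (g \<circ> f)"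
  using assms unfolding isometric_embedding_on_def by auto

lemma equiv_isometry_rel: "equiv (finite_subsets R) (isometry_rel R)"
proof (rule equivI)
  show "isometry_rel R \<subseteq> finite_subsets R \<times> finite_subsets R"
    unfolding isometry_rel_def by auto
  show "refl_on (finite_subsets R) (isometry_rel R)"
    unfolding refl_on_def isometry_rel_def isometric_embedding_on_def
    by (auto intro: exI[of _ "\<lambda>x. x"])
  show "sym (isometry_rel R)"
    unfolding sym_def isometry_rel_def using isometric_embedding_on_inv_into by blast
  show "trans (isometry_rel R)"
  proof (rule transI)
    fix X Y Z assume "(X, Y) \<in> isometry_rel R" "(Y, Z) \<in> isometry_rel R"
    then obtain f g where "isometric_embedding_on X f" "f ` X = Y"
        "isometric_embedding_on Y g" "g ` Y = Z" "X \<in> finite_subsets R" "Z \<in> finite_subsets R"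
      unfolding isometry_rel_def by blast
    moreover from this have "isometric_embedding_on X (g \<circ> f)" "(g \<circ> f) ` X = Z"
      using isometric_embedding_on_comp[of X f g] by (auto simp: image_comp[symmetric])
    ultimately show "(X, Z) \<in> isometry_rel R"
      unfolding isometry_rel_def by blast
  qed
qed

lemma isometric_images_cong:
  fixes X :: "real set" and f :: "real \<Rightarrow> real"
  assumes "isometric_embedding_on X f"
  shows "{i ` f ` X | i :: real \<Rightarrow> real. isometric_embedding_on (f ` X) i} =
         {i ` X | i. isometric_embedding_on X i}" (is "?L = ?R")
proof
  show "?L \<subseteq> ?R"
  proof
    fix Z assume "Z \<in> ?L"
    then obtain i where i: "isometric_embedding_on (f ` X) i" "Z = i ` f ` X" by blast
    have "Z = (i \<circ> f) ` X"
      using i(2) by (simp only: image_comp)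
    with isometric_embedding_on_comp[OF assms i(1)] show "Z \<in> ?R" by blast
  qed
  show "?R \<subseteq> ?L"
  proof
    fix Z assume "Z \<in> ?R"
    then obtain i where i: "isometric_embedding_on X i" "Z = i ` X" by blast
    let ?g = "inv_into X f"
    have g: "isometric_embedding_on (f ` X) ?g" "?g ` f ` X = X"
      using isometric_embedding_on_inv_into[OF assms] by auto
    have "isometric_embedding_on (f ` X) (i \<circ> ?g)"
      using isometric_embedding_on_comp[OF g(1)] i(1) g(2) by simp
    moreover have "Z = (i \<circ> ?g) ` f ` X"
      using g(2) i(2) by (simp only: image_comp[symmetric])
    ultimately show "Z \<in> ?L" by blast
  qed
qed

lemma eucl_hausdorff_dist_cong:
  assumes "isometric_embedding_on X f" "isometric_embedding_on Y g"
  shows "eucl_hausdorff_dist (f ` X) (g ` Y) = eucl_hausdorff_dist X Y"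
proof -
  have *: "eucl_hausdorff_dist X Y = (INF (P, Q) \<in>
      {i ` X | i :: real \<Rightarrow> real. isometric_embedding_on X i} \<times>
      {j ` Y | j :: real \<Rightarrow> real. isometric_embedding_on Y j}. hausdorff_dist P Q)" for X Y
    unfolding eucl_hausdorff_dist_def by (rule arg_cong[of _ _ Inf]) force
  show ?thesis
    unfolding * isometric_images_cong[OF assms(1)] isometric_images_cong[OF assms(2)] ..
qed

lemma EH_dist_class:
  assumes "X \<in> finite_subsets R" "Y \<in> finite_subsets R"
  shows "EH_dist (isometry_rel R `` {X}) (isometry_rel R `` {Y}) = eucl_hausdorff_dist X Y"
proof -
  have "eucl_hausdorff_dist X' Y' = eucl_hausdorff_dist X Y"
    if "(X, X') \<in> isometry_rel R" "(Y, Y') \<in> isometry_rel R" for X' Y'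
    using that unfolding isometry_rel_def by (auto simp: eucl_hausdorff_dist_cong)
  moreover have "(X, X) \<in> isometry_rel R" "(Y, Y) \<in> isometry_rel R"
    using assms equiv_isometry_rel[of R] by (auto simp: equiv_def refl_on_def)
  ultimately have "(\<Union>X'\<in>isometry_rel R `` {X}. \<Union>Y'\<in>isometry_rel R `` {Y}.
      {eucl_hausdorff_dist X' Y'}) = {eucl_hausdorff_dist X Y}"
    by blast
  then show ?thesis unfolding EH_dist_def by simp
qed

end

theory Submission
  imports Defs
begin

text \<open>A bi-Lipschitz image in a finite-dimensional space would be doubling, so it suffices to find,
  for every \<open>N\<close>, a family of \<open>N\<close> sets whose mutual distances all lie in \<open>[s/2, s]\<close> for some \<open>s > 0\<close>.
  Take \<open>s = R/(4N)\<close> and the sets \<open>s \<cdot> ({0, 2, \<dots>, 4N} \<union> {2i+1})\<close>, \<open>i < N\<close>. All distances inside these sets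
  are integer multiples of \<open>s\<close>, so two of them at distance below \<open>s/2\<close> would be isometric; but
  the position of the only odd point relative to the ends of the grid determines \<open>i\<close>, even
  up to reflection, because it lies in the left half.\<close>

section \<open>Separated sets in finite-dimensional inner product spaces\<close>

text \<open>The remainder \<open>?v\<close> is orthogonal to \<open>C\<close> and lies in
  \<open>span C\<close>, hence is orthogonal to itself. A zero vector in \<open>C\<close> does no
  harm, since division by zero yields 0.\<close>

lemma orthogonal_expansion:
  fixes C :: "'a::real_inner set"
  assumes "finite C" "pairwise orthogonal C" "w \<in> span C"
  shows "w = (\<Sum>c\<in>C. (w \<bullet> c / (c \<bullet> c)) *\<^sub>R c)"
proof -
  let ?v = "w - (\<Sum>c\<in>C. (w \<bullet> c / (c \<bullet> c)) *\<^sub>R c)"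
  have "orthogonal ?v x" if "x \<in> C" for x
  proof -
    have "(\<Sum>c\<in>C. (w \<bullet> c / (c \<bullet> c)) *\<^sub>R c) \<bullet> x = (\<Sum>c\<in>C. if c = x then w \<bullet> x else 0)"
      unfolding inner_sum_left
      by (rule sum.cong) (use assms(2) that in \<open>auto simp: pairwise_def orthogonal_def\<close>)
    also have "\<dots> = w \<bullet> x" using assms(1) that by simp
    finally show ?thesis by (simp add: orthogonal_def inner_diff_left)
  qed
  then have "orthogonal ?v ?v"
  proof (rule orthogonal_to_span[rotated])
    show "?v \<in> span C"
      using assms by (intro span_diff span_sum span_scale) (auto intro: span_base)
  qed
  then show ?thesis by (simp add: orthogonal_self)
qed

lemma norm_le_sum_orthogonal_coords:
  fixes C :: "'a::real_inner set"
  assumes "finite C" "pairwise orthogonal C" "w \<in> span C"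
  shows "norm w \<le> (\<Sum>c\<in>C. \<bar>w \<bullet> c / norm c\<bar>)"
proof -
  have "norm w = norm (\<Sum>c\<in>C. (w \<bullet> c / (c \<bullet> c)) *\<^sub>R c)"
    using orthogonal_expansion[OF assms] by (rule arg_cong)
  also have "\<dots> \<le> (\<Sum>c\<in>C. norm ((w \<bullet> c / (c \<bullet> c)) *\<^sub>R c))"
    by (rule norm_sum)
  also have "\<dots> = (\<Sum>c\<in>C. \<bar>w \<bullet> c / norm c\<bar>)"
    by (intro sum.cong refl) (simp add: dot_square_norm power2_eq_square)
  finally show ?thesis .
qed

text \<open>Pigeonhole: the coordinates along an orthogonal spanning set are cut into intervals of
  length \<open>d\<close>. Points of a separated set fall into distinct cells, and boundedness
  leaves finitely many cells. \<open>K\<close> is fixed before \<open>S\<close>, which is what the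
  final contradiction needs.\<close>

lemma bounded_separated_card_bound:
  fixes B :: "'a::real_inner set"
  assumes "finite B" "span B = UNIV" "e > 0"
  obtains K where "\<And>S :: 'a set. finite S \<Longrightarrow> (\<And>x. x \<in> S \<Longrightarrow> norm x \<le> b) \<Longrightarrow>
    (\<And>x y. x \<in> S \<Longrightarrow> y \<in> S \<Longrightarrow> x \<noteq> y \<Longrightarrow> e \<le> dist x y) \<Longrightarrow> card S \<le> K"
proof -
  obtain C :: "'a set" where C: "finite C" "pairwise orthogonal C" "span C = UNIV"
    using basis_orthogonal[OF assms(1)] assms(2) by metis
  \<comment> \<open>The added 1 makes \<open>card C * d\<close> strictly smaller than
    \<open>e\<close> and covers empty \<open>C\<close>.\<close>
  define d where "d = e / (real (card C) + 1)"
  have d: "d > 0" "real (card C) * d < e"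
    using assms(3) by (auto simp: d_def field_simps)
  \<comment> \<open>The cell index of \<open>u\<close>; restricting it to \<open>C\<close> puts it
    in the extensional function space \<open>T\<close>, which is finite.\<close>
  define g where "g = (\<lambda>u. \<lambda>c\<in>C. \<lfloor>(u \<bullet> c / norm c) / d\<rfloor>)"
  define T where "T = C \<rightarrow>\<^sub>E {\<lfloor>- b / d\<rfloor>..\<lfloor>b / d\<rfloor>}"
  have T: "finite T" unfolding T_def by (intro finite_PiE C(1)) auto
  show ?thesis
  proof (rule that[of "card T"])
    fix S :: "'a set"
    assume "finite S" and bd: "\<And>x. x \<in> S \<Longrightarrow> norm x \<le> b"
      and sep: "\<And>x y. x \<in> S \<Longrightarrow> y \<in> S \<Longrightarrow> x \<noteq> y \<Longrightarrow> e \<le> dist x y"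
    show "card S \<le> card T"
    proof (rule card_inj_on_le[OF _ _ T])
      show "inj_on g S"
      proof (rule inj_onI, rule ccontr)
        fix u v assume uv: "u \<in> S" "v \<in> S" "g u = g v" "u \<noteq> v"
        have "\<bar>(u - v) \<bullet> c / norm c\<bar> \<le> d" if "c \<in> C" for c
        proof -
          have "\<lfloor>(u \<bullet> c / norm c) / d\<rfloor> = \<lfloor>(v \<bullet> c / norm c) / d\<rfloor>"
            using fun_cong[OF uv(3), of c] that by (simp add: g_def)
          then have "\<bar>(u \<bullet> c / norm c) / d - (v \<bullet> c / norm c) / d\<bar> \<le> 1" by linarith
          also have "(u \<bullet> c / norm c) / d - (v \<bullet> c / norm c) / d = ((u - v) \<bullet> c / norm c) / d"
            by (simp add: inner_diff_left diff_divide_distrib)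
          finally have "\<bar>((u - v) \<bullet> c / norm c) / d\<bar> \<le> 1" .
          moreover have "\<bar>q\<bar> \<le> d" if "\<bar>q / d\<bar> \<le> 1" for q
            using that d(1) by (simp add: pos_divide_le_eq)
          ultimately show ?thesis by blast
        qed
        then have "(\<Sum>c\<in>C. \<bar>(u - v) \<bullet> c / norm c\<bar>) \<le> real (card C) * d"
          by (rule sum_bounded_above)
        moreover have "norm (u - v) \<le> (\<Sum>c\<in>C. \<bar>(u - v) \<bullet> c / norm c\<bar>)"
          using C by (intro norm_le_sum_orthogonal_coords) auto
        ultimately have "dist u v < e" using d(2) by (simp add: dist_norm)
        with sep[OF uv(1,2,4)] show False by simp
      qed
      show "g ` S \<subseteq> T"
      proof safe
        fix u assume u: "u \<in> S"
        have "\<bar>u \<bullet> c / norm c\<bar> \<le> b" for c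
        proof -
          have "\<bar>u \<bullet> c\<bar> \<le> norm u * norm c" by (rule Cauchy_Schwarz_ineq2)
          then have "\<bar>u \<bullet> c / norm c\<bar> \<le> norm u" by (cases "c = 0") (simp_all add: field_simps)
          with bd[OF u] show ?thesis by linarith
        qed
        then have "- b \<le> u \<bullet> c / norm c" "u \<bullet> c / norm c \<le> b" for c
          by (metis abs_le_D2 minus_le_iff, metis abs_le_D1)
        then have "- b / d \<le> (u \<bullet> c / norm c) / d \<and> (u \<bullet> c / norm c) / d \<le> b / d" for c
          using d(1) by (intro conjI divide_right_mono) auto
        then have "\<lfloor>- b / d\<rfloor> \<le> \<lfloor>(u \<bullet> c / norm c) / d\<rfloor> \<and>
            \<lfloor>(u \<bullet> c / norm c) / d\<rfloor> \<le> \<lfloor>b / d\<rfloor>" for c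
          by (intro conjI floor_mono) auto
        then show "g u \<in> T" unfolding g_def T_def by auto
      qed
    qed
  qed
qed

section \<open>Bounds on the Euclidean-Hausdorff distance\<close>

lemma correspondence_finite_nonempty:
  assumes "correspondence X Y C" "finite X" "X \<noteq> {}" "finite Y"
  shows "finite C" "C \<noteq> {}"
proof -
  show "finite C"
    using assms(1,2,4) finite_subset[of C "X \<times> Y"] by (simp add: correspondence_def)
  show "C \<noteq> {}" using assms(1,3) by (auto simp: correspondence_def)
qed

text \<open>A correspondence between finite sets is finite, so its supremum is bounded above and a
  single distant pair is enough.\<close>

lemma hausdorff_dist_greatest:
  assumes "finite X" "X \<noteq> {}" "finite Y" "Y \<noteq> {}"
    and "\<And>C. correspondence X Y C \<Longrightarrow> \<exists>(x, y)\<in>C. r \<le> \<bar>x - y\<bar>"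
  shows "r \<le> hausdorff_dist X Y"
  unfolding hausdorff_dist_def
proof (rule cINF_greatest)
  have "correspondence X Y (X \<times> Y)" using assms(2,4) by (auto simp: correspondence_def)
  then show "{C. correspondence X Y C} \<noteq> {}" by blast
  fix C assume "C \<in> {C. correspondence X Y C}"
  then have C: "correspondence X Y C" by simp
  obtain x y where "(x, y) \<in> C" "r \<le> \<bar>x - y\<bar>" using assms(5)[OF C] by auto
  then show "r \<le> (SUP (x, y)\<in>C. \<bar>x - y\<bar>)"
    using correspondence_finite_nonempty[OF C assms(1-3)]
    by (intro cSUP_upper2[of _ _ "(x, y)"]) auto
qed

lemma hausdorff_dist_nonneg:
  assumes "finite X" "X \<noteq> {}" "finite Y" "Y \<noteq> {}"
  shows "0 \<le> hausdorff_dist X Y"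
proof (rule hausdorff_dist_greatest[OF assms])
  fix C assume "correspondence X Y C"
  then have "C \<noteq> {}" using assms(1-3) by (rule correspondence_finite_nonempty)
  then show "\<exists>(x, y)\<in>C. 0 \<le> \<bar>x - y\<bar>" by auto
qed

lemma hausdorff_dist_le:
  assumes "finite X" "X \<noteq> {}" "finite Y" "Y \<noteq> {}"
    and "\<And>x. x \<in> X \<Longrightarrow> \<exists>y\<in>Y. \<bar>x - y\<bar> \<le> r" "\<And>y. y \<in> Y \<Longrightarrow> \<exists>x\<in>X. \<bar>x - y\<bar> \<le> r"
  shows "hausdorff_dist X Y \<le> r"
proof -
  \<comment> \<open>All pairs within \<open>r\<close>; the two neighbourhood hypotheses say exactly
    that these form a correspondence.\<close>
  define C where "C = {(x, y). x \<in> X \<and> y \<in> Y \<and> \<bar>x - y\<bar> \<le> r}"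
  have C: "correspondence X Y C" using assms(5,6) by (auto simp: correspondence_def C_def)
  have "0 \<le> (SUP (x, y)\<in>D. \<bar>x - y\<bar>)" if D: "correspondence X Y D" for D
  proof -
    obtain p where "p \<in> D" using correspondence_finite_nonempty(2)[OF D assms(1-3)] by blast
    then show ?thesis
      using correspondence_finite_nonempty(1)[OF D assms(1-3)]
      by (intro cSUP_upper2[of _ _ p]) (auto split: prod.splits)
  qed
  then have "hausdorff_dist X Y \<le> (SUP (x, y)\<in>C. \<bar>x - y\<bar>)"
    unfolding hausdorff_dist_def using C
    by (intro cINF_lower bdd_belowI2[where m = 0]) auto
  also have "\<dots> \<le> r"
    using correspondence_finite_nonempty(2)[OF C assms(1-3)]
    by (intro cSUP_least) (auto simp: C_def)
  finally show ?thesis .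
qed

lemma hausdorff_dist_mem_isometric_images:
  fixes X Y :: "real set"
  shows "hausdorff_dist X Y \<in> {hausdorff_dist (i ` X) (j ` Y) | i j.
    isometric_embedding_on X i \<and> isometric_embedding_on Y j}"
proof -
  have "isometric_embedding_on Z (\<lambda>x. x)" for Z :: "real set"
    by (simp add: isometric_embedding_on_def)
  then show ?thesis unfolding mem_Collect_eq by (metis image_ident)
qed

lemma eucl_hausdorff_dist_le_hausdorff_dist:
  assumes "finite X" "X \<noteq> {}" "finite Y" "Y \<noteq> {}"
  shows "eucl_hausdorff_dist X Y \<le> hausdorff_dist X Y"
  unfolding eucl_hausdorff_dist_def
proof (rule cInf_lower)
  show "hausdorff_dist X Y \<in> {hausdorff_dist (i ` X) (j ` Y) | i j.
      isometric_embedding_on X i \<and> isometric_embedding_on Y j}"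
    by (rule hausdorff_dist_mem_isometric_images)
  show "bdd_below {hausdorff_dist (i ` X) (j ` Y) | i j.
      isometric_embedding_on X i \<and> isometric_embedding_on Y j}"
  proof (rule bdd_belowI[where m = 0])
    fix h assume "h \<in> {hausdorff_dist (i ` X) (j ` Y) | i j.
      isometric_embedding_on X i \<and> isometric_embedding_on Y j}"
    then obtain i j where "h = hausdorff_dist (i ` X) (j ` Y)" by blast
    then show "0 \<le> h" using assms by (simp add: hausdorff_dist_nonneg)
  qed
qed

text \<open>The Gromov-Hausdorff lower bound: half the distortion.\<close>

lemma eucl_hausdorff_dist_ge_distortion:
  assumes "finite X" "X \<noteq> {}" "finite Y" "Y \<noteq> {}"
    and dis: "\<And>C. correspondence X Y C \<Longrightarrow>
      \<exists>(x, y)\<in>C. \<exists>(x', y')\<in>C. 2 * r \<le> \<bar>\<bar>x - x'\<bar> - \<bar>y - y'\<bar>\<bar>"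
  shows "r \<le> eucl_hausdorff_dist X Y"
  unfolding eucl_hausdorff_dist_def
proof (rule cInf_greatest)
  show "{hausdorff_dist (i ` X) (j ` Y) | (i :: real \<Rightarrow> real) (j :: real \<Rightarrow> real).
      isometric_embedding_on X i \<and> isometric_embedding_on Y j} \<noteq> {}"
    using hausdorff_dist_mem_isometric_images by blast
  fix h assume "h \<in> {hausdorff_dist (i ` X) (j ` Y) | i j.
      isometric_embedding_on X i \<and> isometric_embedding_on Y j}"
  then obtain i j where h: "h = hausdorff_dist (i ` X) (j ` Y)"
    and ij: "isometric_embedding_on X i" "isometric_embedding_on Y j" by blast
  have "\<exists>(x, y)\<in>C. r \<le> \<bar>x - y\<bar>" if C: "correspondence (i ` X) (j ` Y) C" for C
  proof (rule ccontr)
    assume "\<not> ?thesis"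
    then have small: "\<bar>x - y\<bar> < r" if "(x, y) \<in> C" for x y using that by fastforce
    \<comment> \<open>Pulled back along \<open>i\<close> and \<open>j\<close>, a correspondence with
      all pairs closer than \<open>r\<close> would have distortion below \<open>2 * r\<close> by the
      triangle inequality.\<close>
    define D where "D = {(x, y). x \<in> X \<and> y \<in> Y \<and> (i x, j y) \<in> C}"
    have "correspondence X Y D" using C unfolding correspondence_def D_def by fastforce
    then obtain x y x' y' where xy: "(x, y) \<in> D" "(x', y') \<in> D"
      and big: "2 * r \<le> \<bar>\<bar>x - x'\<bar> - \<bar>y - y'\<bar>\<bar>" using dis by blast
    have "\<bar>x - x'\<bar> = \<bar>i x - i x'\<bar>" "\<bar>y - y'\<bar> = \<bar>j y - j y'\<bar>"
      using ij xy by (auto simp: isometric_embedding_on_def dist_real_def D_def)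
    moreover have "\<bar>i x - j y\<bar> < r" "\<bar>i x' - j y'\<bar> < r" using xy small by (auto simp: D_def)
    ultimately show False using big by linarith
  qed
  then show "r \<le> h" unfolding h using assms(1-4) by (intro hausdorff_dist_greatest) auto
qed

section \<open>Arbitrarily large families of comparable mutual distances\<close>

text \<open>Integers make parity available and force unequal distances to differ by at least 1. For
  \<open>i < N\<close> the odd mark lies below the midpoint \<open>2 * N\<close>.\<close>

definition marked_grid :: "nat \<Rightarrow> nat \<Rightarrow> int set" where
  "marked_grid N i = insert (2 * int i + 1) ((\<lambda>k. 2 * int k) ` {..2 * N})"

lemma finite_marked_grid: "finite (marked_grid N i)"
  by (simp add: marked_grid_def)

lemma marked_grid_nonempty: "marked_grid N i \<noteq> {}"
  by (simp add: marked_grid_def)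

lemma marked_grid_bounds:
  assumes "i < N" "k \<in> marked_grid N i"
  shows "0 \<le> k" "k \<le> 4 * int N"
  using assms by (auto simp: marked_grid_def)

text \<open>Even points are common to all grids; only the mark may need a partner, and its even left
  neighbour serves.\<close>

lemma marked_grid_near:
  assumes "i < N" "k \<in> marked_grid N i"
  shows "\<exists>l\<in>marked_grid N j. \<bar>k - l\<bar> \<le> 1"
proof -
  consider "k = 2 * int i + 1" | m where "k = 2 * int m" "m \<le> 2 * N"
    using assms(2) by (auto simp: marked_grid_def)
  then show ?thesis
  proof cases
    case 1
    with assms(1) show ?thesis
      by (intro bexI[of _ "2 * int i"]) (auto simp: marked_grid_def)
  next
    case 2
    then show ?thesis
      by (intro bexI[of _ k]) (auto simp: marked_grid_def)
  qed
qed

text \<open>The partners of the two ends are at distance \<open>4 * int N\<close>, hence are ends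
  themselves. So the partner of the mark sits at the same position or at its reflection, both odd,
  and must be the other mark.\<close>

lemma isometric_marked_grids_eq:
  assumes "i < N" "j < N"
    and C: "correspondence (marked_grid N i) (marked_grid N j) C"
    and iso: "\<And>x y x' y'. (x, y) \<in> C \<Longrightarrow> (x', y') \<in> C \<Longrightarrow> \<bar>x - x'\<bar> = \<bar>y - y'\<bar>"
  shows "i = j"
proof -
  have ends: "0 \<in> marked_grid N i" "4 * int N \<in> marked_grid N i"
    and "2 * int i + 1 \<in> marked_grid N i"
    by (auto simp: marked_grid_def image_iff intro: bexI[of _ "2 * N"])
  then obtain p q r where C3: "(0, p) \<in> C" "(4 * int N, q) \<in> C" "(2 * int i + 1, r) \<in> C"
    using C unfolding correspondence_def by metis
  then have m: "p \<in> marked_grid N j" "q \<in> marked_grid N j" "r \<in> marked_grid N j"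
    using C unfolding correspondence_def by auto
  have "\<bar>p - q\<bar> = 4 * int N" using iso[OF C3(1,2)] by simp
  with marked_grid_bounds[OF assms(2)] m have "p = 0 \<or> p = 4 * int N" by smt
  moreover have "\<bar>p - r\<bar> = 2 * int i + 1" using iso[OF C3(1,3)] by simp
  ultimately have r: "r = 2 * int i + 1 \<or> r = 4 * int N - (2 * int i + 1)"
    using marked_grid_bounds[OF assms(2) m(3)] by linarith
  then have "odd r" by auto
  with m(3) have "r = 2 * int j + 1" by (auto simp: marked_grid_def)
  \<comment> \<open>The reflected case would need \<open>i + j = 2 * N - 1\<close>, impossible for
    \<open>i, j < N\<close>.\<close>
  with r assms(1,2) show ?thesis by linarith
qed

section \<open>Grids inside the interval and their mutual distances\<close>

definition scaled_grid :: "real \<Rightarrow> nat \<Rightarrow> nat \<Rightarrow> real set" where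
  "scaled_grid s N i = (\<lambda>k. s * of_int k) ` marked_grid N i"

lemma scaled_grid_finite_subsets:
  assumes "s > 0" "i < N" "4 * real N * s \<le> R"
  shows "scaled_grid s N i \<in> finite_subsets R"
proof -
  have "0 \<le> s * of_int k \<and> s * of_int k \<le> R" if "k \<in> marked_grid N i" for k
  proof
    show "0 \<le> s * of_int k" using marked_grid_bounds(1)[OF assms(2) that] assms(1) by simp
    have "real_of_int k \<le> real_of_int (4 * int N)"
      using marked_grid_bounds(2)[OF assms(2) that] of_int_le_iff by blast
    then have "s * of_int k \<le> s * (4 * real N)" using assms(1) by (intro mult_left_mono) auto
    with assms(3) show "s * of_int k \<le> R" by (simp add: mult.commute)
  qed
  then show ?thesis
    using finite_marked_grid marked_grid_nonempty by (auto simp: finite_subsets_def scaled_grid_def)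
qed

lemma eucl_hausdorff_dist_scaled_grid_le:
  assumes "s > 0" "i < N" "j < N"
  shows "eucl_hausdorff_dist (scaled_grid s N i) (scaled_grid s N j) \<le> s"
proof -
  have near: "\<exists>y\<in>scaled_grid s N l. \<bar>x - y\<bar> \<le> s" if k: "k < N" and x: "x \<in> scaled_grid s N k" for x k l
  proof -
    obtain m where m: "m \<in> marked_grid N k" "x = s * of_int m"
      using x by (auto simp: scaled_grid_def)
    then obtain n where n: "n \<in> marked_grid N l" "\<bar>m - n\<bar> \<le> 1"
      using marked_grid_near[OF k] by blast
    have "\<bar>x - s * of_int n\<bar> = s * of_int \<bar>m - n\<bar>"
      using assms(1) by (simp add: m(2) abs_mult flip: right_diff_distrib)
    also have "\<dots> \<le> s * 1" using n(2) assms(1) by (intro mult_left_mono) auto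
    finally show ?thesis using n(1) by (auto simp: scaled_grid_def)
  qed
  have "finite (scaled_grid s N k)" "scaled_grid s N k \<noteq> {}" for k
    by (simp_all add: scaled_grid_def finite_marked_grid marked_grid_nonempty)
  then have "eucl_hausdorff_dist (scaled_grid s N i) (scaled_grid s N j)
      \<le> hausdorff_dist (scaled_grid s N i) (scaled_grid s N j)"
    and "hausdorff_dist (scaled_grid s N i) (scaled_grid s N j) \<le> s"
    using near[OF assms(2)] near[OF assms(3)]
    by (auto intro!: eucl_hausdorff_dist_le_hausdorff_dist hausdorff_dist_le simp: abs_minus_commute)
  then show ?thesis by linarith
qed

text \<open>Every correspondence distorts some distance, by a nonzero integer multiple of
  \<open>s\<close>; half of this distortion bounds the distance from below.\<close>

lemma eucl_hausdorff_dist_scaled_grid_ge: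
  assumes "s > 0" "i < N" "j < N" "i \<noteq> j"
  shows "s / 2 \<le> eucl_hausdorff_dist (scaled_grid s N i) (scaled_grid s N j)"
proof (rule eucl_hausdorff_dist_ge_distortion)
  fix C assume C: "correspondence (scaled_grid s N i) (scaled_grid s N j) C"
  define D where "D = {(m, n). m \<in> marked_grid N i \<and> n \<in> marked_grid N j \<and>
    (s * of_int m, s * of_int n) \<in> C}"
  have "correspondence (marked_grid N i) (marked_grid N j) D"
    using C unfolding correspondence_def D_def scaled_grid_def by fastforce
  then obtain m n m' n' where D: "(m, n) \<in> D" "(m', n') \<in> D" "\<bar>m - m'\<bar> \<noteq> \<bar>n - n'\<bar>"
    using isometric_marked_grids_eq[OF assms(2,3)] assms(4) by metis
  have "1 \<le> \<bar>\<bar>m - m'\<bar> - \<bar>n - n'\<bar>\<bar>" using D(3) by linarith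
  then have "s * 1 \<le> s * of_int \<bar>\<bar>m - m'\<bar> - \<bar>n - n'\<bar>\<bar>"
    using assms(1) by (intro mult_left_mono) linarith+
  also have "\<dots> = \<bar>\<bar>s * of_int m - s * of_int m'\<bar> - \<bar>s * of_int n - s * of_int n'\<bar>\<bar>"
    using assms(1) by (simp add: abs_mult flip: right_diff_distrib)
  finally show "\<exists>(x, y)\<in>C. \<exists>(x', y')\<in>C. 2 * (s / 2) \<le> \<bar>\<bar>x - x'\<bar> - \<bar>y - y'\<bar>\<bar>"
    using D(1,2) unfolding D_def by fastforce
qed (simp_all add: scaled_grid_def finite_marked_grid marked_grid_nonempty)

section \<open>Contradiction with the packing bound\<close>

theorem theorem5p1:
  fixes R :: real
  assumes "R > 0"
    and "\<exists>B :: 'h::{real_inner, complete_space} set. finite B \<and> span B = UNIV"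
  shows "\<not> (\<exists>\<psi> :: real set set \<Rightarrow> 'h.
    bilipschitz_embedding (EH_space R) EH_dist UNIV dist \<psi>)"
proof
  assume "\<exists>\<psi> :: real set set \<Rightarrow> 'h. bilipschitz_embedding (EH_space R) EH_dist UNIV dist \<psi>"
  then obtain \<psi> :: "real set set \<Rightarrow> 'h" and a b where ab: "a > 0" "b > 0"
    and lip: "\<And>P Q. P \<in> EH_space R \<Longrightarrow> Q \<in> EH_space R \<Longrightarrow>
      a * EH_dist P Q \<le> dist (\<psi> P) (\<psi> Q) \<and> dist (\<psi> P) (\<psi> Q) \<le> b * EH_dist P Q"
    unfolding bilipschitz_embedding_def by blast
  obtain B :: "'h set" where B: "finite B" "span B = UNIV" using assms(2) by blast
  have "a / 2 > 0" using ab by simp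
  then obtain K where K: "\<And>S :: 'h set. finite S \<Longrightarrow> (\<And>x. x \<in> S \<Longrightarrow> norm x \<le> b) \<Longrightarrow>
      (\<And>x y. x \<in> S \<Longrightarrow> y \<in> S \<Longrightarrow> x \<noteq> y \<Longrightarrow> a / 2 \<le> dist x y) \<Longrightarrow> card S \<le> K"
    using bounded_separated_card_bound[OF B] by metis
  \<comment> \<open>One grid more than the packing bound allows; \<open>K\<close> depends on
    \<open>a\<close>, \<open>b\<close> and \<open>B\<close> only, so \<open>N\<close> and the scale
    \<open>s\<close> can be chosen afterwards.\<close>
  define N where "N = Suc K"
  define s where "s = R / (4 * real N)"
  have s: "s > 0" "4 * real N * s \<le> R" using assms(1) by (simp_all add: s_def N_def)
  define P where "P = (\<lambda>i. isometry_rel R `` {scaled_grid s N i})"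
  \<comment> \<open>Translation places \<open>f 0\<close> at the origin, so bounds on distances
    become bounds on norms. Division by \<open>s\<close> brings the distances between distinct
    indices below \<open>N\<close> into the range from \<open>a / 2\<close> to \<open>b\<close>,
    whatever \<open>N\<close> is.\<close>
  define f where "f = (\<lambda>i. (\<psi> (P i) - \<psi> (P 0)) /\<^sub>R s)"
  note fs = scaled_grid_finite_subsets[OF s(1) _ s(2)]
  have EH: "P i \<in> EH_space R" if "i < N" for i
    unfolding P_def EH_space_def by (intro quotientI fs that)
  have distf: "dist (f i) (f j) = dist (\<psi> (P i)) (\<psi> (P j)) / s" for i j
    using s(1) by (simp add: f_def dist_norm divide_inverse flip: scaleR_diff_right)
  have EHd: "EH_dist (P i) (P j) = eucl_hausdorff_dist (scaled_grid s N i) (scaled_grid s N j)"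
    if "i < N" "j < N" for i j
    unfolding P_def by (intro EH_dist_class fs that)
  have upper: "dist (f i) (f j) \<le> b" if "i < N" "j < N" for i j
  proof -
    have "dist (\<psi> (P i)) (\<psi> (P j)) \<le> b * EH_dist (P i) (P j)" using lip EH that by blast
    also have "\<dots> \<le> b * s"
      unfolding EHd[OF that] using ab that s(1)
      by (intro mult_left_mono eucl_hausdorff_dist_scaled_grid_le) auto
    finally show ?thesis using s(1) by (simp add: distf pos_divide_le_eq)
  qed
  have lower: "a / 2 \<le> dist (f i) (f j)" if "i < N" "j < N" "i \<noteq> j" for i j
  proof -
    have "a * (s / 2) \<le> a * EH_dist (P i) (P j)"
      unfolding EHd[OF that(1,2)] using ab that s(1)
      by (intro mult_left_mono eucl_hausdorff_dist_scaled_grid_ge) auto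
    also have "\<dots> \<le> dist (\<psi> (P i)) (\<psi> (P j))" using lip EH that by blast
    finally show ?thesis using s(1) by (simp add: distf pos_le_divide_eq)
  qed
  have "inj_on f {..<N}"
  proof (rule inj_onI, rule ccontr)
    fix i j assume "i \<in> {..<N}" "j \<in> {..<N}" "f i = f j" "i \<noteq> j"
    with lower[of i j] ab(1) show False by simp
  qed
  then have "card (f ` {..<N}) = N" by (simp add: card_image)
  moreover have "card (f ` {..<N}) \<le> K"
  proof (rule K)
    show "norm x \<le> b" if x: "x \<in> f ` {..<N}" for x
    proof -
      have "f 0 = 0" by (simp add: f_def)
      moreover obtain i where "x = f i" "i < N" using x by auto
      ultimately show ?thesis using upper[of i 0] by (simp add: N_def)
    qed
    show "a / 2 \<le> dist x y" if "x \<in> f ` {..<N}" "y \<in> f ` {..<N}" "x \<noteq> y" for x y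
      using that lower by auto
  qed simp
  ultimately show False by (simp add: N_def)
qed

end
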